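(* Let $R=\mathbb F_{q^m}[x;\sigma,\delta]$, let $s\ge 1$, $n\ge 1$ be integers, let $\mathbf w\in\mathbb Z_{\ge 0}^{s+1}$, and let $\mathscr E_0,\dots,\mathscr E_{n-1}:R^{s+1}\to\mathbb F_{q^m}$ be $\mathbb F_{q^m}$-linear maps with kernels $\mathcal K_i=\{\mathbf Q\in R^{s+1}:\mathscr E_i(\mathbf Q)=0\}$, such that $\mathcal K_0\cap\mathcal K_1\cap\dots\cap\mathcal K_i$ is a left $R$-submodule of $R^{s+1}$ for every $i=0,\dots,n-1$. Assume that for all $0\le i\le j\le n-1$ there is given a vector $\mathbf M_{[i,j]}\in R^{s+1}$ (of minimal skew polynomials depending on $\mathscr E_i,\dots,\mathscr E_j$) such that $$\mathscr E_l(\mathbf Q)=\mathscr E_l(\mathbf Q \bmod_{\mathrm r}\mathbf M_{[i,j]})\qquad\text{for all }\mathbf Q\in R^{s+1}\text{ and all } l=i,\dots,j .$$ Then the procedure $\mathsf{SkewInterpolateTree}$ described in the context is correct, i.e. it meets the following specification. Input: the maps $(\mathscr E_{i_1},\dots,\mathscr E_{i_2})$ with $0\le i_1\le i_2\le n-1$, a matrix $\mathbf B\in R^{(s+1)\times(s+1)}$ with rows $\mathbf b_0,\dots,\mathbf b_s$, and $\mathbf d=(d_0,\dots,d_s)\in\mathbb Z_{\ge0}^{s+1}$ with $d_j=\deg_{\mathbf w}(\mathbf b_j)$ for all $j=0,\dots,s$. Output: a matrix $\mathbf T\in R^{(s+1)\times(s+1)}$ such that $\hat{\mathbf B}:=\mathbf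 T\mathbf B$ is a $\mathbf w$-ordered weak-Popov basis for $\langle\mathbf B\rangle\cap\mathcal K_{i_1}\cap\dots\cap\mathcal K_{i_2}$, and $\hat{\mathbf d}=(\hat d_0,\dots,\hat d_s)\in\mathbb Z_{\ge0}^{s+1}$ with $\hat d_j=\deg_{\mathbf w}(\hat{\mathbf b}_j)$ for all $j=0,\dots,s$, where $\hat{\mathbf b}_j$ is the $j$-th row of $\hat{\mathbf B}$.
   Context: $q$ is a prime power, $m\ge1$, $\sigma$ is a field automorphism of $\mathbb F_{q^m}$, and $\delta:\mathbb F_{q^m}\to\mathbb F_{q^m}$ is a $\sigma$-derivation: $\delta(a+b)=\delta(a)+\delta(b)$ and $\delta(ab)=\delta(a)b+\sigma(a)\delta(b)$. $R=\mathbb F_{q^m}[x;\sigma,\delta]$ is the skew polynomial ring: polynomials $\sum_i f_ix^i$ with coefficients on the left, ordinary addition, and multiplication determined by $xa=\sigma(a)x+\delta(a)$. For $f,g\in R$, $g\neq0$, $f\bmod_{\mathrm r} g$ is the remainder $r$ of right division $f=q'g+r$, $\deg r<\deg g$. For vectors in $R^{s+1}$, $\bmod_{\mathrm r}$ acts componentwise; for a matrix $\mathbf B$ and a vector $\mathbf M$, $\mathbf B\bmod_{\mathrm r}\mathbf M$ is obtained by replacing each row $\mathbf b_j$ by $\mathbf b_j\bmod_{\mathrm r}\mathbf M$. $\langle\mathbf B\rangle$ is the left $R$-module spanned by the rows of $\mathbf B$. Indices start at $0$. For $\mathbf a\in R^{s+1}$: $\deg_{\mathbf w}(\mathbf a)=\max_j\{\deg(a_j)+w_j\}$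 (with $\deg 0=-\infty$); for $\mathbf a\ne\mathbf 0$ the $\mathbf w$-pivot index of $\mathbf a$ is the largest $j$ with $\deg(a_j)+w_j=\deg_{\mathbf w}(\mathbf a)$. A matrix over $R$ is in $\mathbf w$-ordered weak Popov form if the $\mathbf w$-pivot indices of its rows are strictly increasing in the row index. A $\mathbf w$-ordered weak-Popov basis of a left $R$-submodule $\mathcal M\subseteq R^{s+1}$ is a full-rank matrix in $R^{(s+1)\times(s+1)}$ in $\mathbf w$-ordered weak Popov form whose rows form a basis of $\mathcal M$. Procedure $\mathsf{SkewInterpolatePoint}(\mathscr E_i,\mathbf B,\mathbf d)$: compute $\Delta_j=\mathscr E_i(\mathbf b_j)$ for $j=0,\dots,s$ and $\mathcal J=\{j:\Delta_j\neq0\}$. If $\mathcal J=\emptyset$ return $(\mathbf I_{s+1},\mathbf d)$. Otherwise let $j^*$ be the smallest index in $\mathcal J$ at which $d_j$, $j\in\mathcal J$, is minimal; let $\mathbf U$ be the matrix that equals the identity except for column $j^*$, whose entries are $U_{j,j^*}=-\Delta_j/\Delta_{j^*}$ for $j\ne j^*$ and $U_{j^*,j^*}=x-\mathscr E_i(x\,\mathbf b_{j^*})/\Delta_{j^*}$; return $(\mathbf U,\hat{\mathbf d})$ where $\hat{\mathbf d}$ is $\mathbf d$ with entry $j^*$ increased by $1$. Procedure $\mathsf{SkewInterpolateTree}((\mathscr E_{i_1},\dots,\mathscr E_{i_2}),\mathbf B,\mathbf d)$: if $i_1=i_2$ return $\mathsf{SkewInterpolatePoint}(\mathscr E_{i_1},\mathbf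 B,\mathbf d)$. Otherwise set $z=\lfloor(i_1+i_2)/2\rfloor$; $\mathbf B_1=\mathbf B\bmod_{\mathrm r}\mathbf M_{[i_1,z]}$; $(\mathbf T_1,\mathbf d_1)=\mathsf{SkewInterpolateTree}((\mathscr E_{i_1},\dots,\mathscr E_z),\mathbf B_1,\mathbf d)$; $\mathbf B_2=(\mathbf T_1\mathbf B)\bmod_{\mathrm r}\mathbf M_{[z+1,i_2]}$; $(\mathbf T_2,\mathbf d_2)=\mathsf{SkewInterpolateTree}((\mathscr E_{z+1},\dots,\mathscr E_{i_2}),\mathbf B_2,\mathbf d_1)$; return $(\mathbf T_2\mathbf T_1,\mathbf d_2)$.
   Formalization: The input B is also required to be in w-ordered weak Popov form and, if i_1>0, ⟨B⟩∩K_{i_1}∩…∩K_i is required to be a left submodule for every i_1≤i≤i_2; without these the claim fails, e.g. for B with two equal nonzero rows. *)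

theory Defs
  imports
    "Jordan_Normal_Form.Matrix"
    "HOL-Library.Extended"
    "HOL-Library.Cardinality"
    "HOL-Number_Theory.Prime_Powers"
    "HOL-Computational_Algebra.Polynomial"
begin

subsection \<open>The skew polynomial ring\<close>

definition field_automorphism :: "('a::field \<Rightarrow> 'a) \<Rightarrow> bool" where
  "field_automorphism \<sigma> \<longleftrightarrow> bij \<sigma> \<and> \<sigma> 1 = 1 \<and>
     (\<forall>a b. \<sigma> (a + b) = \<sigma> a + \<sigma> b) \<and> (\<forall>a b. \<sigma> (a * b) = \<sigma> a * \<sigma> b)"

definition skew_derivation :: "('a::field \<Rightarrow> 'a) \<Rightarrow> ('a \<Rightarrow> 'a) \<Rightarrow> bool" where
  "skew_derivation \<sigma> \<delta> \<longleftrightarrow>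
     (\<forall>a b. \<delta> (a + b) = \<delta> a + \<delta> b) \<and> (\<forall>a b. \<delta> (a * b) = \<delta> a * b + \<sigma> a * \<delta> b)"

text \<open>
  The elements of \<open>R = F[x; \<sigma>, \<delta>]\<close> are represented by the type \<open>'a poly\<close>, where
  \<open>coeff f i\<close> is the left coefficient of \<open>x\<^sup>i\<close>. Zero, one, addition, subtraction and degree
  are those of \<open>'a poly\<close>; the commutative product of \<open>'a poly\<close> is not the product of \<open>R\<close>, which is
  \<open>skew_mult \<sigma> \<delta>\<close>. The latter is obtained from left multiplication by \<open>x\<close>,
  \<open>x (\<Sum>j. g\<^sub>j x\<^sup>j) = \<Sum>j. (\<sigma> g\<^sub>j x\<^sup>j\<^sup>+\<^sup>1 + \<delta> g\<^sub>j x\<^sup>j)\<close>.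
\<close>

definition skew_X_mult :: "('a::field \<Rightarrow> 'a) \<Rightarrow> ('a \<Rightarrow> 'a) \<Rightarrow> 'a poly \<Rightarrow> 'a poly" where
  "skew_X_mult \<sigma> \<delta> g = pCons 0 (map_poly \<sigma> g) + map_poly \<delta> g"

definition skew_mult :: "('a::field \<Rightarrow> 'a) \<Rightarrow> ('a \<Rightarrow> 'a) \<Rightarrow> 'a poly \<Rightarrow> 'a poly \<Rightarrow> 'a poly" where
  "skew_mult \<sigma> \<delta> f g = (\<Sum>i\<le>degree f. smult (coeff f i) ((skew_X_mult \<sigma> \<delta> ^^ i) g))"

definition sdeg :: "'a::zero poly \<Rightarrow> nat extended" where
  "sdeg f = (if f = 0 then -\<infinity> else Fin (degree f))"

text \<open>Meaningful for \<open>g \<noteq> 0\<close> only; existence and uniqueness are shown in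
  \<open>skew_right_division\<close> below.\<close>

definition skew_mod :: "('a::field \<Rightarrow> 'a) \<Rightarrow> ('a \<Rightarrow> 'a) \<Rightarrow> 'a poly \<Rightarrow> 'a poly \<Rightarrow> 'a poly" where
  "skew_mod \<sigma> \<delta> f g = (THE r. sdeg r < sdeg g \<and> (\<exists>q. f = skew_mult \<sigma> \<delta> q g + r))"

locale skew_poly_ring =
  fixes \<sigma> \<delta> :: "'a::field \<Rightarrow> 'a"
  assumes aut: "field_automorphism \<sigma>" and der: "skew_derivation \<sigma> \<delta>"
begin

abbreviation X where "X \<equiv> skew_X_mult \<sigma> \<delta>"
abbreviation smul (infixl \<open>\<star>\<close> 70) where "f \<star> g \<equiv> skew_mult \<sigma> \<delta> f g"

lemma s_add: "\<sigma> (a + b) = \<sigma> a + \<sigma> b" and s_mult: "\<sigma> (a * b) = \<sigma> a * \<sigma> b" and s_1: "\<sigma> 1 = 1"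
  and d_add: "\<delta> (a + b) = \<delta> a + \<delta> b" and d_mult: "\<delta> (a * b) = \<delta> a * b + \<sigma> a * \<delta> b"
  and s_inj: "inj \<sigma>"
  using aut der by (auto simp: field_automorphism_def skew_derivation_def bij_def)

lemma s_0 [simp]: "\<sigma> 0 = 0" using s_add[of 0 0] by (metis add.right_neutral add_left_cancel)
lemma d_0 [simp]: "\<delta> 0 = 0" using d_add[of 0 0] by (metis add.right_neutral add_left_cancel)
lemma d_1 [simp]: "\<delta> 1 = 0" using d_mult[of 1 1] unfolding s_1 mult_1_left mult_1_right by (metis add.right_neutral add_left_cancel)
lemma s_eq_0 [simp]: "\<sigma> a = 0 \<longleftrightarrow> a = 0" using s_inj s_0 by (metis injD)

lemma X_add: "X (g + h) = X g + X h"
  by (intro poly_eqI) (auto simp: skew_X_mult_def coeff_map_poly coeff_pCons s_add d_add split: nat.splits)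

lemma X_0 [simp]: "X 0 = 0" by (simp add: skew_X_mult_def)

lemma X_smult: "X (smult a g) = smult (\<sigma> a) (X g) + smult (\<delta> a) g"
  by (intro poly_eqI)
    (auto simp: skew_X_mult_def coeff_map_poly coeff_pCons s_mult d_mult algebra_simps split: nat.splits)

lemma X_monom: "X (monom a j) = monom (\<sigma> a) (Suc j) + monom (\<delta> a) j"
  by (simp add: skew_X_mult_def map_poly_monom monom_Suc)

lemma Xp_add: "(X ^^ i) (g + h) = (X ^^ i) g + (X ^^ i) h"
  by (induction i) (auto simp: X_add)

lemma Xp_0 [simp]: "(X ^^ i) 0 = 0" by (induction i) auto

lemma mult_bound:
  assumes "degree f \<le> N"
  shows "f \<star> g = (\<Sum>i\<le>N. smult (coeff f i) ((X ^^ i) g))"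
  unfolding skew_mult_def
  by (rule sum.mono_neutral_left) (use assms in \<open>auto simp: coeff_eq_0\<close>)

lemma mult_add_left: "(f + f') \<star> g = f \<star> g + f' \<star> g"
proof -
  define N where "N = max (degree f) (degree f')"
  have "degree (f + f') \<le> N" "degree f \<le> N" "degree f' \<le> N"
    by (auto simp: N_def degree_add_le_max)
  thus ?thesis by (simp add: mult_bound smult_add_left sum.distrib)
qed

lemma mult_add_right: "f \<star> (g + h) = f \<star> g + f \<star> h"
  by (simp add: skew_mult_def Xp_add smult_add_right sum.distrib)

lemma mult_0_left [simp]: "0 \<star> g = 0" and mult_0_right [simp]: "f \<star> 0 = 0"
  by (simp_all add: skew_mult_def)

lemma mult_monom: "monom a i \<star> g = smult a ((X ^^ i) g)"
proof -
  have "monom a i \<star> g = (\<Sum>k\<le>i. smult (coeff (monom a i) k) ((X ^^ k) g))"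
    by (rule mult_bound) (simp add: degree_monom_le)
  also have "\<dots> = (\<Sum>k\<le>i. if k = i then smult a ((X ^^ i) g) else 0)"
    by (rule sum.cong) auto
  finally show ?thesis by simp
qed

lemma mult_1_left: "1 \<star> g = g"
  using mult_monom[of 1 0 g] by (simp flip: one_pCons add: monom_0)

lemma Xp_1: "(X ^^ i) 1 = monom 1 i"
  by (induction i) (simp_all add: X_monom s_1 monom_0 flip: one_pCons)

lemma mult_1_right: "f \<star> 1 = f"
  by (simp add: skew_mult_def Xp_1 smult_monom poly_as_sum_of_monoms)

lemma mult_smult_left: "smult a g \<star> h = smult a (g \<star> h)"
proof -
  have "smult a g \<star> h = (\<Sum>i\<le>degree g. smult (coeff (smult a g) i) ((X ^^ i) h))"
    by (rule mult_bound) (simp add: degree_smult_le)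
  also have "\<dots> = smult a (g \<star> h)"
    by (simp add: skew_mult_def poly_eq_iff coeff_sum sum_distrib_left mult.assoc)
  finally show ?thesis .
qed

text \<open>The commutation rule \<open>x a = \<sigma>(a) x + \<delta>(a)\<close>, and the axioms determining the product.\<close>

lemma X_commutation: "monom 1 1 \<star> [:a:] = [:\<delta> a, \<sigma> a:]"
  using X_monom[of a 0] mult_monom[of 1 1 "[:a:]"] by (simp add: monom_0 monom_Suc)

lemma monom_add_induct:
  assumes "\<And>a i. P (monom a i)" and "\<And>f g. P f \<Longrightarrow> P g \<Longrightarrow> P (f + g)"
  shows "P (f :: 'a poly)"
proof -
  have "P (\<Sum>i\<le>n. monom (coeff f i) i)" for n
    by (induction n) (use assms in auto)
  thus ?thesis using poly_as_sum_of_monoms[of f] by metis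
qed

lemma X_mult_left: "X g \<star> h = X (g \<star> h)"
  by (induction g rule: monom_add_induct)
    (simp_all add: X_monom mult_add_left mult_monom X_smult X_add)

lemma Xp_mult_left: "(X ^^ i) g \<star> h = (X ^^ i) (g \<star> h)"
  by (induction i) (simp_all add: X_mult_left)

lemma mult_assoc: "(f \<star> g) \<star> h = f \<star> (g \<star> h)"
  by (induction f rule: monom_add_induct)
    (simp_all add: mult_monom mult_smult_left Xp_mult_left mult_add_left)

lemma degree_X:
  assumes "g \<noteq> 0"
  shows "degree (X g) = Suc (degree g)" "X g \<noteq> 0"
    and "coeff (X g) (Suc (degree g)) = \<sigma> (lead_coeff g)"
proof -
  have c: "coeff (X g) (Suc n) = \<sigma> (coeff g n) + \<delta> (coeff g (Suc n))" for n
    by (simp add: skew_X_mult_def coeff_map_poly)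
  show 1: "coeff (X g) (Suc (degree g)) = \<sigma> (lead_coeff g)"
    by (simp add: c coeff_eq_0)
  have "degree (X g) \<le> Suc (degree g)"
    by (rule degree_le) (metis c Suc_lessE add_0 coeff_eq_0 d_0 less_SucI s_0)
  moreover have "degree (X g) \<ge> Suc (degree g)"
    by (rule le_degree) (use 1 assms in simp)
  ultimately show "degree (X g) = Suc (degree g)" by simp
  show "X g \<noteq> 0" using 1 assms by auto
qed

lemma degree_Xp:
  assumes "g \<noteq> 0"
  shows "(X ^^ i) g \<noteq> 0 \<and> degree ((X ^^ i) g) = i + degree g"
  by (induction i) (use assms degree_X in auto)

lemma degree_mult:
  assumes "f \<noteq> 0" "g \<noteq> 0"
  shows "degree (f \<star> g) = degree f + degree g" "f \<star> g \<noteq> 0"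
proof -
  have "coeff (f \<star> g) (degree f + degree g)
      = (\<Sum>i\<le>degree f. coeff f i * coeff ((X ^^ i) g) (degree f + degree g))"
    by (simp add: skew_mult_def coeff_sum)
  also have "\<dots> = (\<Sum>i\<le>degree f. if i = degree f then lead_coeff f * lead_coeff ((X ^^ degree f) g) else 0)"
    by (rule sum.cong) (use degree_Xp[OF assms(2)] in \<open>auto simp: coeff_eq_0\<close>)
  finally have *: "coeff (f \<star> g) (degree f + degree g)
      = lead_coeff f * lead_coeff ((X ^^ degree f) g)" by simp
  have **: "coeff (f \<star> g) (degree f + degree g) \<noteq> 0"
    
  proof -
    have "lead_coeff ((X ^^ degree f) g) \<noteq> 0" "lead_coeff f \<noteq> 0"
      using assms degree_Xp[OF assms(2), of "degree f"] by (metis leading_coeff_0_iff)+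
    with * show ?thesis by (metis mult_eq_0_iff)
  qed
  have "degree (f \<star> g) \<le> degree f + degree g"
    unfolding skew_mult_def
    by (rule degree_sum_le) (use degree_Xp[OF assms(2)] in
        \<open>auto intro: order_trans[OF degree_smult_le]\<close>)
  with ** show "degree (f \<star> g) = degree f + degree g" by (meson le_antisym le_degree)
  show "f \<star> g \<noteq> 0" using ** by auto
qed

lemma skew_right_division:
  assumes "g \<noteq> 0"
  shows "\<exists>!r. sdeg r < sdeg g \<and> (\<exists>q. f = q \<star> g + r)"
proof (rule ex_ex1I)
  show "\<exists>r. sdeg r < sdeg g \<and> (\<exists>q. f = q \<star> g + r)"
  proof (induction f rule: measure_induct_rule[where f = "\<lambda>f. if f = 0 then 0 else Suc (degree f)"])
    case (less f)
    show ?case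
    proof (cases "sdeg f < sdeg g")
      case True
      thus ?thesis by (intro exI[of _ f]) (auto intro: exI[of _ 0])
    next
      case False
      hence f: "f \<noteq> 0" "degree g \<le> degree f" using assms by (auto simp: sdeg_def split: if_splits)
      define k where "k = degree f - degree g"
      define h where "h = (X ^^ k) g"
      have h: "h \<noteq> 0" "degree h = degree f" using degree_Xp[OF assms, of k] f by (auto simp: h_def k_def)
      define c where "c = lead_coeff f / lead_coeff h"
      define f' where "f' = f - smult c h"
      have "f' = 0 \<or> degree f' < degree f"
      proof (cases "degree f = 0")
        case True
        hence "f' = 0" using h unfolding f'_def c_def
          by (metis degree_eq_zeroE degree_0 diff_self lead_coeff_pCons(2) leading_coeff_0_iff nonzero_divide_eq_eq pCons_0_0 smult_0_right smult_pCons coeff_pCons_0)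
        thus ?thesis ..
      next
        case False
        have "degree f' \<le> degree f" unfolding f'_def
          by (rule degree_diff_le) (use h in \<open>auto intro: order_trans[OF degree_smult_le]\<close>)
        moreover have "coeff f' (degree f) = 0" 
        proof -
          have "coeff h (degree f) \<noteq> 0" using h by (metis leading_coeff_0_iff)
          thus ?thesis using h by (simp add: f'_def c_def)
        qed
        ultimately show ?thesis
          by (metis le_neq_implies_less leading_coeff_0_iff)
      qed
      with f have "(if f' = 0 then 0 else Suc (degree f')) < (if f = 0 then 0 else Suc (degree f))"
        by auto
      from less.IH[OF this] obtain r q where "sdeg r < sdeg g" "f' = q \<star> g + r" by blast
      moreover have "smult c h = monom c k \<star> g" by (simp add: mult_monom h_def)
      ultimately have "f = (q + monom c k) \<star> g + r"
        by (simp add: f'_def mult_add_left algebra_simps)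
      with \<open>sdeg r < sdeg g\<close> show ?thesis by blast
    qed
  qed
next
  fix r r'
  assume "sdeg r < sdeg g \<and> (\<exists>q. f = q \<star> g + r)" "sdeg r' < sdeg g \<and> (\<exists>q. f = q \<star> g + r')"
  then obtain q q' where q: "f = q \<star> g + r" "f = q' \<star> g + r'"
    and d: "sdeg r < sdeg g" "sdeg r' < sdeg g" by blast
  have "q \<star> g = (q - q') \<star> g + q' \<star> g" by (simp flip: mult_add_left)
  hence e: "(q - q') \<star> g = r' - r" using q by (simp add: algebra_simps)
  have "q - q' = 0"
  proof (rule ccontr)
    assume "q - q' \<noteq> 0"
    hence "degree g \<le> degree (r' - r)" "r' - r \<noteq> 0"
      using degree_mult[OF _ assms, of "q - q'"] e by auto
    moreover have "r' - r = 0 \<or> degree (r' - r) < degree g"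
      using d assms by (auto simp: sdeg_def degree_diff_less split: if_splits)
    ultimately show False by auto
  qed
  thus "r = r'" using e by simp
qed

end


subsection \<open>Vectors and matrices over the skew polynomial ring\<close>

text \<open>
  Elements of \<open>R\<^sup>N\<close> are \<open>v \<in> carrier_vec N\<close>. Only the additive structure of
  \<open>'a poly vec\<close> and \<open>'a poly mat\<close> is that of \<open>R\<close>; the products \<open>\<cdot>\<^sub>v\<close>, \<open>*\<close>, ... of the
  matrix library use the commutative product of \<open>'a poly\<close> and are replaced as follows.
\<close>

definition skew_smult_vec ::
    "('a::field \<Rightarrow> 'a) \<Rightarrow> ('a \<Rightarrow> 'a) \<Rightarrow> 'a poly \<Rightarrow> 'a poly vec \<Rightarrow> 'a poly vec" where
  "skew_smult_vec \<sigma> \<delta> f v = map_vec (skew_mult \<sigma> \<delta> f) v"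

definition skew_vec_mat_mult ::
    "('a::field \<Rightarrow> 'a) \<Rightarrow> ('a \<Rightarrow> 'a) \<Rightarrow> 'a poly vec \<Rightarrow> 'a poly mat \<Rightarrow> 'a poly vec" where
  "skew_vec_mat_mult \<sigma> \<delta> c B =
     vec (dim_col B) (\<lambda>k. \<Sum>j<dim_row B. skew_mult \<sigma> \<delta> (c $ j) (B $$ (j, k)))"

definition skew_mat_mult ::
    "('a::field \<Rightarrow> 'a) \<Rightarrow> ('a \<Rightarrow> 'a) \<Rightarrow> 'a poly mat \<Rightarrow> 'a poly mat \<Rightarrow> 'a poly mat" where
  "skew_mat_mult \<sigma> \<delta> A B =
     mat (dim_row A) (dim_col B)
       (\<lambda>(i, k). \<Sum>j<dim_row B. skew_mult \<sigma> \<delta> (A $$ (i, j)) (B $$ (j, k)))"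

definition skew_mod_vec ::
    "('a::field \<Rightarrow> 'a) \<Rightarrow> ('a \<Rightarrow> 'a) \<Rightarrow> 'a poly vec \<Rightarrow> 'a poly vec \<Rightarrow> 'a poly vec" where
  "skew_mod_vec \<sigma> \<delta> v M = vec (dim_vec v) (\<lambda>k. skew_mod \<sigma> \<delta> (v $ k) (M $ k))"

definition skew_mod_mat ::
    "('a::field \<Rightarrow> 'a) \<Rightarrow> ('a \<Rightarrow> 'a) \<Rightarrow> 'a poly mat \<Rightarrow> 'a poly vec \<Rightarrow> 'a poly mat" where
  "skew_mod_mat \<sigma> \<delta> B M =
     mat_of_rows (dim_col B) (map (\<lambda>b. skew_mod_vec \<sigma> \<delta> b M) (rows B))"

definition left_submodule ::
    "('a::field \<Rightarrow> 'a) \<Rightarrow> ('a \<Rightarrow> 'a) \<Rightarrow> nat \<Rightarrow> 'a poly vec set \<Rightarrow> bool" where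
  "left_submodule \<sigma> \<delta> N H \<longleftrightarrow>
     H \<subseteq> carrier_vec N \<and> 0\<^sub>v N \<in> H \<and> (\<forall>u\<in>H. \<forall>v\<in>H. u + v \<in> H) \<and>
     (\<forall>f. \<forall>v\<in>H. skew_smult_vec \<sigma> \<delta> f v \<in> H)"

definition row_module ::
    "('a::field \<Rightarrow> 'a) \<Rightarrow> ('a \<Rightarrow> 'a) \<Rightarrow> 'a poly mat \<Rightarrow> 'a poly vec set" where
  "row_module \<sigma> \<delta> B = {skew_vec_mat_mult \<sigma> \<delta> c B | c. c \<in> carrier_vec (dim_row B)}"

definition rows_left_indep ::
    "('a::field \<Rightarrow> 'a) \<Rightarrow> ('a \<Rightarrow> 'a) \<Rightarrow> 'a poly mat \<Rightarrow> nat set \<Rightarrow> bool" where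
  "rows_left_indep \<sigma> \<delta> B I \<longleftrightarrow>
     (\<forall>c\<in>carrier_vec (dim_row B).
        (\<forall>j<dim_row B. j \<notin> I \<longrightarrow> c $ j = 0) \<and> skew_vec_mat_mult \<sigma> \<delta> c B = 0\<^sub>v (dim_col B)
        \<longrightarrow> c = 0\<^sub>v (dim_row B))"

definition left_row_rank ::
    "('a::field \<Rightarrow> 'a) \<Rightarrow> ('a \<Rightarrow> 'a) \<Rightarrow> 'a poly mat \<Rightarrow> nat" where
  "left_row_rank \<sigma> \<delta> B = Max {card I | I. I \<subseteq> {..<dim_row B} \<and> rows_left_indep \<sigma> \<delta> B I}"


subsection \<open>Ordered weak Popov form\<close>

definition wdeg :: "nat vec \<Rightarrow> 'a::zero poly vec \<Rightarrow> nat extended" where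
  "wdeg w a = Max ((\<lambda>j. sdeg (a $ j) + Fin (w $ j)) ` {..<dim_vec a})"

definition pivot_index :: "nat vec \<Rightarrow> 'a::zero poly vec \<Rightarrow> nat" where
  "pivot_index w a = Max {j. j < dim_vec a \<and> sdeg (a $ j) + Fin (w $ j) = wdeg w a}"

text \<open>A zero vector has no pivot index (for it, \<open>pivot_index\<close> is a meaningless value), so all rows
  are required to be nonzero.\<close>

definition ordered_weak_popov :: "nat vec \<Rightarrow> 'a::zero poly mat \<Rightarrow> bool" where
  "ordered_weak_popov w B \<longleftrightarrow>
     (\<forall>i<dim_row B. row B i \<noteq> 0\<^sub>v (dim_col B)) \<and>
     (\<forall>i<dim_row B. \<forall>j<dim_row B. i < j \<longrightarrow> pivot_index w (row B i) < pivot_index w (row B j))"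

definition ordered_weak_popov_basis ::
    "('a::field \<Rightarrow> 'a) \<Rightarrow> ('a \<Rightarrow> 'a) \<Rightarrow> nat \<Rightarrow> nat vec \<Rightarrow> 'a poly mat \<Rightarrow> 'a poly vec set \<Rightarrow> bool" where
  "ordered_weak_popov_basis \<sigma> \<delta> N w B H \<longleftrightarrow>
     left_submodule \<sigma> \<delta> N H \<and> B \<in> carrier_mat N N \<and> left_row_rank \<sigma> \<delta> B = N \<and>
     ordered_weak_popov w B \<and>
     rows_left_indep \<sigma> \<delta> B {..<N} \<and> row_module \<sigma> \<delta> B = H"


subsection \<open>The interpolation procedures\<close>

definition vector_functional ::
    "('a::field \<Rightarrow> 'a) \<Rightarrow> ('a \<Rightarrow> 'a) \<Rightarrow> nat \<Rightarrow> ('a poly vec \<Rightarrow> 'a) \<Rightarrow> bool" where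
  "vector_functional \<sigma> \<delta> N E \<longleftrightarrow>
     (\<forall>u\<in>carrier_vec N. \<forall>v\<in>carrier_vec N. E (u + v) = E u + E v) \<and>
     (\<forall>a. \<forall>v\<in>carrier_vec N. E (skew_smult_vec \<sigma> \<delta> [:a:] v) = a * E v)"

definition functional_kernel :: "nat \<Rightarrow> ('a::field poly vec \<Rightarrow> 'a) \<Rightarrow> 'a poly vec set" where
  "functional_kernel N E = {Q \<in> carrier_vec N. E Q = 0}"

definition skew_interpolate_point ::
    "('a::field \<Rightarrow> 'a) \<Rightarrow> ('a \<Rightarrow> 'a) \<Rightarrow> ('a poly vec \<Rightarrow> 'a) \<Rightarrow> 'a poly mat \<Rightarrow> nat vec
      \<Rightarrow> 'a poly mat \<times> nat vec" where
  "skew_interpolate_point \<sigma> \<delta> E B d =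
     (let N = dim_row B;
          \<Delta> = (\<lambda>j. E (row B j));
          J = {j. j < N \<and> \<Delta> j \<noteq> 0}
      in if J = {} then (1\<^sub>m N, d)
         else let jstar = (LEAST j. j \<in> J \<and> (\<forall>i\<in>J. d $ j \<le> d $ i));
                  U = mat N N (\<lambda>(j, k).
                    if k \<noteq> jstar then (if j = k then 1 else 0)
                    else if j \<noteq> jstar then [:- \<Delta> j / \<Delta> jstar:]
                    else monom 1 1
                      - [:E (skew_smult_vec \<sigma> \<delta> (monom 1 1) (row B jstar)) / \<Delta> jstar:]);
                  dhat = vec (dim_vec d) (\<lambda>j. if j = jstar then d $ j + 1 else d $ j)
              in (U, dhat))"

text \<open>\<open>E l\<close> and \<open>M i j\<close> stand for the maps \<open>\<E>\<^sub>l\<close> and the vectors \<open>M\<^bsub>[i,j]\<^esub>\<close>; the procedure is only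
  meant to be called with \<open>i1 \<le> i2\<close>.\<close>

function skew_interpolate_tree ::
    "('a::field \<Rightarrow> 'a) \<Rightarrow> ('a \<Rightarrow> 'a) \<Rightarrow> (nat \<Rightarrow> 'a poly vec \<Rightarrow> 'a) \<Rightarrow> (nat \<Rightarrow> nat \<Rightarrow> 'a poly vec)
      \<Rightarrow> nat \<Rightarrow> nat \<Rightarrow> 'a poly mat \<Rightarrow> nat vec \<Rightarrow> 'a poly mat \<times> nat vec" where
  "skew_interpolate_tree \<sigma> \<delta> E M i1 i2 B d =
     (if i1 \<ge> i2 then skew_interpolate_point \<sigma> \<delta> (E i1) B d
      else let z = (i1 + i2) div 2;
               B1 = skew_mod_mat \<sigma> \<delta> B (M i1 z);
               (T1, d1) = skew_interpolate_tree \<sigma> \<delta> E M i1 z B1 d;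
               B2 = skew_mod_mat \<sigma> \<delta> (skew_mat_mult \<sigma> \<delta> T1 B) (M (z + 1) i2);
               (T2, d2) = skew_interpolate_tree \<sigma> \<delta> E M (z + 1) i2 B2 d1
           in (skew_mat_mult \<sigma> \<delta> T2 T1, d2))"
  by pat_completeness auto
termination
  by (relation "measure (\<lambda>(\<sigma>, \<delta>, E, M, i1, i2, B, d). i2 - i1)") auto

end

theory Submission
  imports Defs
begin

text \<open>
  The procedure sees a row \<open>b\<close> of its input only through the values \<open>\<E>\<^sub>l (f b)\<close> for \<open>f \<in> R\<close>, and
  reduction modulo \<open>M\<^bsub>[i,j]\<^esub>\<close> does not change these for \<open>i \<le> l \<le> j\<close>. Hence the recursion can be
  analysed as if it were run on unreduced matrices, and only a single step is left to study. There the
  pivot of row \<open>j\<close> of \<open>B\<close> is at position \<open>j\<close>; the choice of \<open>j\<^sup>*\<close> keeps all pivots in place while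
  subtracting multiples of row \<open>j\<^sup>*\<close>, and right division by the \<open>j\<^sup>*\<close>-th diagonal entry of \<open>U\<close> leaves
  only a constant multiple of \<open>b\<^bsub>j\<^sup>*\<^esub>\<close> outside the span of \<open>U B\<close>, on which \<open>\<E>\<close> vanishes only if it is zero.
\<close>

subsection \<open>Pivots\<close>

text \<open>Weighted degree \<open>D\<close> and pivot index \<open>p\<close>, stated through conditions on single coefficients so
  that the effect of row operations can be checked coefficientwise.\<close>

definition has_pivot :: "nat vec \<Rightarrow> 'a::zero poly vec \<Rightarrow> nat \<Rightarrow> nat \<Rightarrow> bool" where
  "has_pivot w a p D \<longleftrightarrow>
     p < dim_vec a \<and> w $ p \<le> D \<and> coeff (a $ p) (D - w $ p) \<noteq> 0 \<and>
     (\<forall>k<dim_vec a. \<forall>i. D < i + w $ k \<or> p < k \<and> D = i + w $ k \<longrightarrow> coeff (a $ k) i = 0)"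

lemma has_pivot_degree:
  assumes "has_pivot w a p D"
  shows "a $ p \<noteq> 0" "degree (a $ p) + w $ p = D"
    and "k < dim_vec a \<Longrightarrow> a $ k \<noteq> 0 \<Longrightarrow> degree (a $ k) + w $ k \<le> D"
    and "k < dim_vec a \<Longrightarrow> a $ k \<noteq> 0 \<Longrightarrow> p < k \<Longrightarrow> degree (a $ k) + w $ k < D"
proof -
  show p: "a $ p \<noteq> 0" using assms by (auto simp: has_pivot_def)
  have le: "degree (a $ k) + w $ k \<le> D" if "k < dim_vec a" "a $ k \<noteq> 0" for k
    using assms that by (metis has_pivot_def leI leading_coeff_0_iff)
  have "D - w $ p \<le> degree (a $ p)" using assms by (auto simp: has_pivot_def intro: le_degree)
  with le[of p] p assms show "degree (a $ p) + w $ p = D" by (auto simp: has_pivot_def)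
  show "k < dim_vec a \<Longrightarrow> a $ k \<noteq> 0 \<Longrightarrow> degree (a $ k) + w $ k \<le> D" by (rule le)
  show "k < dim_vec a \<Longrightarrow> a $ k \<noteq> 0 \<Longrightarrow> p < k \<Longrightarrow> degree (a $ k) + w $ k < D"
    using assms le[of k] by (metis has_pivot_def le_neq_implies_less leading_coeff_0_iff)
qed

lemma has_pivotI:
  assumes "p < dim_vec a" "a $ p \<noteq> 0" "degree (a $ p) + w $ p = D"
    and "\<And>k. k < dim_vec a \<Longrightarrow> a $ k \<noteq> 0 \<Longrightarrow> degree (a $ k) + w $ k \<le> D"
    and "\<And>k. k < dim_vec a \<Longrightarrow> a $ k \<noteq> 0 \<Longrightarrow> p < k \<Longrightarrow> degree (a $ k) + w $ k \<noteq> D"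
  shows "has_pivot w a p D"
proof -
  have "coeff (a $ k) i = 0" if "k < dim_vec a" "D < i + w $ k \<or> p < k \<and> D = i + w $ k" for k i
  proof (cases "a $ k = 0")
    case False
    hence "degree (a $ k) < i" using assms(4,5)[of k] that by auto
    thus ?thesis by (rule coeff_eq_0)
  qed simp
  moreover have "D - w $ p = degree (a $ p)" using assms(3) by simp
  ultimately show ?thesis unfolding has_pivot_def using assms(1-3) by auto
qed

lemma ex_has_pivot:
  assumes "a \<in> carrier_vec N" "a \<noteq> 0\<^sub>v N"
  obtains p D where "has_pivot w a p D"
proof -
  define S where "S = {k. k < N \<and> a $ k \<noteq> 0}"
  define D where "D = Max ((\<lambda>k. degree (a $ k) + w $ k) ` S)"
  define P where "P = {k \<in> S. degree (a $ k) + w $ k = D}"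
  have fin: "finite S" "finite P" by (auto simp: S_def P_def)
  have "S \<noteq> {}" using assms by (auto simp: S_def vec_eq_iff)
  hence "D \<in> (\<lambda>k. degree (a $ k) + w $ k) ` S" using fin unfolding D_def by (intro Max_in) auto
  hence "P \<noteq> {}" by (auto simp: P_def)
  hence max: "Max P \<in> P" using fin by (intro Max_in)
  have "has_pivot w a (Max P) D"
  proof (rule has_pivotI)
    fix k assume "k < dim_vec a" "a $ k \<noteq> 0"
    hence k: "k \<in> S" using assms(1) by (simp add: S_def)
    thus "degree (a $ k) + w $ k \<le> D" unfolding D_def using fin by (intro Max_ge) auto
    show "degree (a $ k) + w $ k \<noteq> D" if "Max P < k"
      using Max_ge[OF fin(2), of k] that k by (auto simp: P_def)
  qed (use max assms(1) in \<open>auto simp: P_def S_def\<close>)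
  thus thesis by (rule that)
qed

lemma has_pivot_imp:
  assumes "has_pivot w a p D"
  shows "wdeg w a = Fin D" "pivot_index w a = p" "a \<noteq> 0\<^sub>v (dim_vec a)"
proof -
  note h = has_pivot_degree[OF assms]
  have p: "p < dim_vec a" using assms by (simp add: has_pivot_def)
  have D: "sdeg (a $ p) + Fin (w $ p) = Fin D" using h by (simp add: sdeg_def)
  show *: "wdeg w a = Fin D"
    unfolding wdeg_def
  proof (rule Max_eqI)
    show "Fin D \<in> (\<lambda>j. sdeg (a $ j) + Fin (w $ j)) ` {..<dim_vec a}" using p D by force
  qed (use h in \<open>auto simp: sdeg_def\<close>)
  show "pivot_index w a = p"
    unfolding pivot_index_def *
  proof (rule Max_eqI)
    fix k assume "k \<in> {j. j < dim_vec a \<and> sdeg (a $ j) + Fin (w $ j) = Fin D}"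
    thus "k \<le> p" using h(4)[of k] by (auto simp: sdeg_def split: if_splits intro: leI)
  qed (use p D in auto)
  show "a \<noteq> 0\<^sub>v (dim_vec a)" using h(1) p by (metis index_zero_vec(1))
qed

lemma strict_mono_self_map:
  fixes f :: "nat \<Rightarrow> nat"
  assumes mono: "\<And>i j. i < j \<Longrightarrow> j < N \<Longrightarrow> f i < f j" and bound: "\<And>i. i < N \<Longrightarrow> f i < N" and "i < N"
  shows "f i = i"
proof -
  have step: "f i + k \<le> f (i + k)" if "i + k < N" for i k
    using that
  proof (induction k)
    case (Suc k)
    with mono[of "i + k" "i + Suc k"] show ?case by simp
  qed simp
  have "i \<le> f i" using step[of 0 i] \<open>i < N\<close> by simp
  moreover have "f i + (N - 1 - i) < N"
    using step[of i "N - 1 - i"] bound[of "N - 1"] \<open>i < N\<close> by simp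
  ultimately show ?thesis using \<open>i < N\<close> by linarith
qed

lemma ordered_weak_popov_iff_diagonal_pivots:
  assumes "B \<in> carrier_mat N N"
  shows "ordered_weak_popov w B \<and> (\<forall>j<N. Fin (d $ j) = wdeg w (row B j)) \<longleftrightarrow>
    (\<forall>j<N. has_pivot w (row B j) j (d $ j))"
proof
  assume L: "ordered_weak_popov w B \<and> (\<forall>j<N. Fin (d $ j) = wdeg w (row B j))"
  have ex: "\<exists>D. has_pivot w (row B j) (pivot_index w (row B j)) D" if "j < N" for j
  proof -
    have "row B j \<in> carrier_vec N" "row B j \<noteq> 0\<^sub>v N"
      using L that assms by (auto simp: ordered_weak_popov_def)
    then obtain p D where "has_pivot w (row B j) p D" by (rule ex_has_pivot)
    with has_pivot_imp(2)[OF this] show ?thesis by auto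
  qed
  have "pivot_index w (row B j) = j" if "j < N" for j
  proof (rule strict_mono_self_map[where N = N, OF _ _ that])
    show "pivot_index w (row B i) < pivot_index w (row B j)" if "i < j" "j < N" for i j
      using L that assms by (auto simp: ordered_weak_popov_def)
    show "pivot_index w (row B i) < N" if "i < N" for i
      using ex[OF that] assms by (auto simp: has_pivot_def)
  qed
  thus "\<forall>j<N. has_pivot w (row B j) j (d $ j)"
    using ex L has_pivot_imp(1) by (metis extended.inject)
next
  assume R: "\<forall>j<N. has_pivot w (row B j) j (d $ j)"
  show "ordered_weak_popov w B \<and> (\<forall>j<N. Fin (d $ j) = wdeg w (row B j))"
    using R assms has_pivot_imp[of w "row B j" j "d $ j" for j]
    by (auto simp: ordered_weak_popov_def)
qed

context skew_poly_ring
begin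

abbreviation vsmul (infixr \<open>\<star>\<^sub>v\<close> 70) where "f \<star>\<^sub>v v \<equiv> skew_smult_vec \<sigma> \<delta> f v"
abbreviation rmul (infixl \<open>\<star>\<^sub>r\<close> 70) where "c \<star>\<^sub>r B \<equiv> skew_vec_mat_mult \<sigma> \<delta> c B"
abbreviation mmul (infixl \<open>\<star>\<^sub>m\<close> 70) where "A \<star>\<^sub>m B \<equiv> skew_mat_mult \<sigma> \<delta> A B"

lemma diagonal_pivots_imp_indep:
  assumes "B \<in> carrier_mat N N" and piv: "\<And>j. j < N \<Longrightarrow> has_pivot w (row B j) j (d $ j)"
  shows "rows_left_indep \<sigma> \<delta> B {..<N}"
proof -
  have "c = 0\<^sub>v N" if c: "c \<in> carrier_vec N" and 0: "c \<star>\<^sub>r B = 0\<^sub>v N" for c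
  proof (rule ccontr)
    assume "c \<noteq> 0\<^sub>v N"
    with c obtain p D where cp: "has_pivot d c p D" by (rule ex_has_pivot)
    note hc = has_pivot_degree[OF cp]
    have p: "p < N" using cp c by (simp add: has_pivot_def)
    note hp = has_pivot_degree[OF piv[OF p]]
    define m where "m = degree (c $ p) + degree (B $$ (p, p))"
    have zero: "coeff (c $ k \<star> B $$ (k, p)) m = 0" if k: "k < N" "k \<noteq> p" for k
    proof (cases "c $ k = 0 \<or> B $$ (k, p) = 0")
      case False
      note hk = has_pivot_degree(3,4)[OF piv[OF k(1)], of p]
      have "degree (c $ k) + d $ k \<le> D" "p < k \<Longrightarrow> degree (c $ k) + d $ k < D"
        using hc(3,4)[of k] False k c by auto
      moreover have "degree (B $$ (k, p)) + w $ p \<le> d $ k"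
        "k < p \<Longrightarrow> degree (B $$ (k, p)) + w $ p < d $ k"
        using hk False k p assms(1) by auto
      moreover have "degree (c $ p) + d $ p = D" "degree (B $$ (p, p)) + w $ p = d $ p"
        using hc(2) hp(2) p assms(1) by auto
      ultimately have "degree (c $ k) + degree (B $$ (k, p)) < m"
        using k(2) unfolding m_def by linarith
      thus ?thesis using False degree_mult(1) by (intro coeff_eq_0) auto
    qed auto
    have "0 = coeff ((c \<star>\<^sub>r B) $ p) m" using 0 p by simp
    also have "\<dots> = (\<Sum>k<N. coeff (c $ k \<star> B $$ (k, p)) m)"
      using p assms(1) by (simp add: skew_vec_mat_mult_def coeff_sum)
    also have "\<dots> = (\<Sum>k<N. if k = p then coeff (c $ p \<star> B $$ (p, p)) m else 0)"
      using zero by (intro sum.cong) auto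
    also have "\<dots> = coeff (c $ p \<star> B $$ (p, p)) m" using p by simp
    finally show False
      using degree_mult[of "c $ p" "B $$ (p, p)"] hc(1) hp(1) p assms(1)
      by (metis carrier_matD index_row(1) leading_coeff_0_iff m_def)
  qed
  thus ?thesis using assms(1) by (auto simp: rows_left_indep_def)
qed

lemma left_row_rank_indep:
  assumes "rows_left_indep \<sigma> \<delta> B {..<dim_row B}"
  shows "left_row_rank \<sigma> \<delta> B = dim_row B"
proof -
  have "card I \<le> dim_row B" if "I \<subseteq> {..<dim_row B}" for I
    using card_mono[OF _ that] by simp
  moreover have "finite {card I | I. I \<subseteq> {..<dim_row B} \<and> rows_left_indep \<sigma> \<delta> B I}"
    by (rule finite_subset[of _ "card ` Pow {..<dim_row B}"]) auto
  moreover have "dim_row B \<in> {card I | I. I \<subseteq> {..<dim_row B} \<and> rows_left_indep \<sigma> \<delta> B I}"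
    using assms by (intro CollectI exI[of _ "{..<dim_row B}"]) auto
  ultimately show ?thesis unfolding left_row_rank_def by (intro Max_eqI) auto
qed

subsection \<open>Linear algebra over the skew polynomial ring\<close>

lemma mult_minus_left: "(- f) \<star> g = - (f \<star> g)"
  using mult_add_left[of f "- f" g] by (simp add: eq_neg_iff_add_eq_0 add.commute)

lemma mult_sum_left: "(\<Sum>i\<in>I. f i) \<star> g = (\<Sum>i\<in>I. f i \<star> g)"
  by (induction I rule: infinite_finite_induct) (auto simp: mult_add_left)

lemma mult_sum_right: "g \<star> (\<Sum>i\<in>I. f i) = (\<Sum>i\<in>I. g \<star> f i)"
  by (induction I rule: infinite_finite_induct) (auto simp: mult_add_right)

lemma mult_const: "[:a:] \<star> g = smult a g"
  using mult_monom[of a 0] by (simp add: monom_0)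

lemma skew_mod_add_mult: "skew_mod \<sigma> \<delta> (q \<star> g + f) g = skew_mod \<sigma> \<delta> f g"
proof -
  have "(\<exists>q'. q \<star> g + f = q' \<star> g + r) \<longleftrightarrow> (\<exists>q'. f = q' \<star> g + r)" for r
  proof
    assume "\<exists>q'. q \<star> g + f = q' \<star> g + r"
    then obtain q' where "q \<star> g + f = q' \<star> g + r" ..
    hence "f = (q' + - q) \<star> g + r"
      unfolding mult_add_left mult_minus_left by (simp add: algebra_simps)
    thus "\<exists>q'. f = q' \<star> g + r" ..
  next
    assume "\<exists>q'. f = q' \<star> g + r"
    then obtain q' where "f = q' \<star> g + r" ..
    hence "q \<star> g + f = (q + q') \<star> g + r" by (simp add: mult_add_left add.assoc)
    thus "\<exists>q'. q \<star> g + f = q' \<star> g + r" ..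
  qed
  thus ?thesis by (simp add: skew_mod_def)
qed

lemma skew_mod_decomp:
  assumes "g \<noteq> 0"
  obtains q where "f = q \<star> g + skew_mod \<sigma> \<delta> f g"
  using theI'[OF skew_right_division[OF assms], of f] by (auto simp flip: skew_mod_def)

lemma skew_mod_mult_mod:
  assumes "g \<noteq> 0"
  shows "skew_mod \<sigma> \<delta> (h \<star> skew_mod \<sigma> \<delta> f g) g = skew_mod \<sigma> \<delta> (h \<star> f) g"
proof -
  obtain q where "f = q \<star> g + skew_mod \<sigma> \<delta> f g" using assms by (rule skew_mod_decomp)
  hence "h \<star> f = (h \<star> q) \<star> g + h \<star> skew_mod \<sigma> \<delta> f g" by (metis mult_add_right mult_assoc)
  thus ?thesis by (simp add: skew_mod_add_mult)
qed

lemma skew_mod_vec_smult_mod: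
  assumes "v \<in> carrier_vec N" "\<forall>k<N. M $ k \<noteq> 0"
  shows "skew_mod_vec \<sigma> \<delta> (f \<star>\<^sub>v skew_mod_vec \<sigma> \<delta> v M) M = skew_mod_vec \<sigma> \<delta> (f \<star>\<^sub>v v) M"
  using assms by (auto simp: skew_mod_vec_def skew_smult_vec_def skew_mod_mult_mod intro!: eq_vecI)

lemma smult_vec_carrier [simp]: "f \<star>\<^sub>v v \<in> carrier_vec N \<longleftrightarrow> v \<in> carrier_vec N"
  by (simp add: skew_smult_vec_def)

lemma add_smult_vec: "(f + g) \<star>\<^sub>v v = f \<star>\<^sub>v v + g \<star>\<^sub>v v"
  by (auto simp: skew_smult_vec_def mult_add_left)

lemma rmul_carrier [simp]: "c \<star>\<^sub>r B \<in> carrier_vec N \<longleftrightarrow> dim_col B = N"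
  by (auto simp: skew_vec_mat_mult_def)

lemma mmul_carrier: "A \<in> carrier_mat m n \<Longrightarrow> B \<in> carrier_mat n k \<Longrightarrow> A \<star>\<^sub>m B \<in> carrier_mat m k"
  by (auto simp: skew_mat_mult_def)

lemma mmul_dim [simp]: "dim_row (A \<star>\<^sub>m B) = dim_row A" "dim_col (A \<star>\<^sub>m B) = dim_col B"
  by (simp_all add: skew_mat_mult_def)

lemma row_mmul:
  assumes "i < dim_row A" "dim_col A = dim_row B"
  shows "row (A \<star>\<^sub>m B) i = row A i \<star>\<^sub>r B"
  using assms by (auto simp: skew_mat_mult_def skew_vec_mat_mult_def intro!: eq_vecI)

lemma smult_rmul:
  assumes "c \<in> carrier_vec (dim_row B)"
  shows "f \<star>\<^sub>v (c \<star>\<^sub>r B) = (f \<star>\<^sub>v c) \<star>\<^sub>r B"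
  using assms
  by (auto simp: skew_smult_vec_def skew_vec_mat_mult_def mult_sum_right mult_assoc intro!: eq_vecI sum.cong)

lemma add_rmul:
  assumes "c \<in> carrier_vec (dim_row B)" "c' \<in> carrier_vec (dim_row B)"
  shows "c \<star>\<^sub>r B + c' \<star>\<^sub>r B = (c + c') \<star>\<^sub>r B"
  using assms by (auto simp: skew_vec_mat_mult_def mult_add_left sum.distrib intro!: eq_vecI)

lemma rmul_assoc:
  assumes "c \<in> carrier_vec (dim_row A)" "dim_col A = dim_row B"
  shows "c \<star>\<^sub>r (A \<star>\<^sub>m B) = (c \<star>\<^sub>r A) \<star>\<^sub>r B"
proof (rule eq_vecI)
  fix k assume "k < dim_vec ((c \<star>\<^sub>r A) \<star>\<^sub>r B)"
  hence k: "k < dim_col B" by (simp add: skew_vec_mat_mult_def)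
  have "(c \<star>\<^sub>r (A \<star>\<^sub>m B)) $ k
      = (\<Sum>j<dim_row A. \<Sum>i<dim_row B. c $ j \<star> A $$ (j, i) \<star> B $$ (i, k))"
    using k by (simp add: skew_vec_mat_mult_def skew_mat_mult_def mult_sum_right mult_assoc)
  also have "\<dots> = ((c \<star>\<^sub>r A) \<star>\<^sub>r B) $ k"
    using k assms by (subst sum.swap) (simp add: skew_vec_mat_mult_def mult_sum_left)
  finally show "(c \<star>\<^sub>r (A \<star>\<^sub>m B)) $ k = ((c \<star>\<^sub>r A) \<star>\<^sub>r B) $ k" .
qed (simp add: skew_vec_mat_mult_def skew_mat_mult_def)

lemma mmul_assoc:
  assumes "dim_col A = dim_row B" "dim_col B = dim_row C"
  shows "(A \<star>\<^sub>m B) \<star>\<^sub>m C = A \<star>\<^sub>m (B \<star>\<^sub>m C)"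
proof (rule eq_rowI)
  fix i assume "i < dim_row (A \<star>\<^sub>m (B \<star>\<^sub>m C))"
  thus "row ((A \<star>\<^sub>m B) \<star>\<^sub>m C) i = row (A \<star>\<^sub>m (B \<star>\<^sub>m C)) i"
    using assms rmul_assoc[of "row A i" B C] row_carrier[of A i] by (simp add: row_mmul)
qed simp_all

lemma mmul_one_left: "1\<^sub>m (dim_row B) \<star>\<^sub>m B = B"
proof (rule eq_matI)
  fix i k assume "i < dim_row B" "k < dim_col B"
  moreover have "(\<Sum>j<dim_row B. 1\<^sub>m (dim_row B) $$ (i, j) \<star> B $$ (j, k))
      = (\<Sum>j<dim_row B. if j = i then B $$ (i, k) else 0)"
    using \<open>i < dim_row B\<close> by (intro sum.cong) (auto simp: mult_1_left)
  ultimately show "(1\<^sub>m (dim_row B) \<star>\<^sub>m B) $$ (i, k) = B $$ (i, k)"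
    by (simp add: skew_mat_mult_def)
qed (simp_all add: skew_mat_mult_def)

lemma unit_rmul:
  assumes "j < dim_row B"
  shows "(f \<star>\<^sub>v unit_vec (dim_row B) j) \<star>\<^sub>r B = f \<star>\<^sub>v row B j"
proof (rule eq_vecI)
  fix k assume "k < dim_vec (f \<star>\<^sub>v row B j)"
  hence k: "k < dim_col B" by (simp add: skew_smult_vec_def)
  have "((f \<star>\<^sub>v unit_vec (dim_row B) j) \<star>\<^sub>r B) $ k
      = (\<Sum>i<dim_row B. (f \<star> (if i = j then 1 else 0)) \<star> B $$ (i, k))"
    using k assms by (simp add: skew_vec_mat_mult_def skew_smult_vec_def)
  also have "\<dots> = (\<Sum>i<dim_row B. if i = j then f \<star> B $$ (j, k) else 0)"
    by (intro sum.cong) (auto simp: mult_1_right)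
  finally show "((f \<star>\<^sub>v unit_vec (dim_row B) j) \<star>\<^sub>r B) $ k = (f \<star>\<^sub>v row B j) $ k"
    using k assms by (simp add: skew_smult_vec_def)
qed (simp add: skew_vec_mat_mult_def skew_smult_vec_def)

lemma row_moduleI: "c \<in> carrier_vec (dim_row B) \<Longrightarrow> c \<star>\<^sub>r B \<in> row_module \<sigma> \<delta> B"
  by (auto simp: row_module_def)

lemma smult_one [simp]: "1 \<star>\<^sub>v v = v"
  by (auto simp: skew_smult_vec_def mult_1_left)

lemma row_in_row_module: "j < dim_row B \<Longrightarrow> row B j \<in> row_module \<sigma> \<delta> B"
  using row_moduleI[of "1 \<star>\<^sub>v unit_vec (dim_row B) j" B] by (simp only: unit_rmul) simp

lemma left_submodule_row_module: "left_submodule \<sigma> \<delta> (dim_col B) (row_module \<sigma> \<delta> B)"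
  unfolding left_submodule_def
proof (intro conjI allI ballI)
  have "0\<^sub>v (dim_col B) = 0\<^sub>v (dim_row B) \<star>\<^sub>r B"
    by (auto simp: skew_vec_mat_mult_def)
  thus "0\<^sub>v (dim_col B) \<in> row_module \<sigma> \<delta> B" unfolding row_module_def by fastforce
next
  fix u v assume "u \<in> row_module \<sigma> \<delta> B" "v \<in> row_module \<sigma> \<delta> B"
  then obtain c c' where "c \<in> carrier_vec (dim_row B)" "u = c \<star>\<^sub>r B"
    "c' \<in> carrier_vec (dim_row B)" "v = c' \<star>\<^sub>r B" by (auto simp: row_module_def)
  thus "u + v \<in> row_module \<sigma> \<delta> B" by (simp add: add_rmul row_moduleI)
next
  fix f v assume "v \<in> row_module \<sigma> \<delta> B"
  then obtain c where "c \<in> carrier_vec (dim_row B)" "v = c \<star>\<^sub>r B" by (auto simp: row_module_def)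
  thus "f \<star>\<^sub>v v \<in> row_module \<sigma> \<delta> B" by (simp add: smult_rmul row_moduleI)
qed (auto simp: row_module_def)

lemma left_submodule_Int:
  "left_submodule \<sigma> \<delta> N G \<Longrightarrow> left_submodule \<sigma> \<delta> N H \<Longrightarrow> left_submodule \<sigma> \<delta> N (G \<inter> H)"
  by (auto simp: left_submodule_def)

lemma left_submodule_combination:
  assumes "left_submodule \<sigma> \<delta> N H" "finite S" "\<And>j. j \<in> S \<Longrightarrow> u j \<in> H"
  shows "vec N (\<lambda>k. \<Sum>j\<in>S. u j $ k) \<in> H"
  using assms(2,3)
proof (induction S)
  case empty
  have "vec N (\<lambda>k. \<Sum>j\<in>{}. u j $ k) = 0\<^sub>v N" by auto
  thus ?case using assms(1) by (simp add: left_submodule_def)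
next
  case (insert i S)
  have "u i \<in> carrier_vec N" using insert assms(1) by (auto simp: left_submodule_def)
  hence "vec N (\<lambda>k. \<Sum>j\<in>insert i S. u j $ k) = u i + vec N (\<lambda>k. \<Sum>j\<in>S. u j $ k)"
    using insert by auto
  thus ?case using insert assms(1) by (auto simp: left_submodule_def)
qed

lemma rmul_eq_combination:
  assumes "B \<in> carrier_mat m N"
  shows "c \<star>\<^sub>r B = vec N (\<lambda>k. \<Sum>j<m. (c $ j \<star>\<^sub>v row B j) $ k)"
  using assms by (auto simp: skew_vec_mat_mult_def skew_smult_vec_def)

lemma row_module_subset:
  assumes "left_submodule \<sigma> \<delta> N H" "B \<in> carrier_mat m N" "\<And>j. j < m \<Longrightarrow> row B j \<in> H"
  shows "row_module \<sigma> \<delta> B \<subseteq> H"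
proof -
  have "c \<star>\<^sub>r B \<in> H" for c
    unfolding rmul_eq_combination[OF assms(2)]
    by (rule left_submodule_combination[OF assms(1)]) (use assms in \<open>auto simp: left_submodule_def\<close>)
  thus ?thesis by (auto simp: row_module_def)
qed

lemma row_module_mmul_subset:
  assumes "dim_col A = dim_row B"
  shows "row_module \<sigma> \<delta> (A \<star>\<^sub>m B) \<subseteq> row_module \<sigma> \<delta> B"
proof
  fix v assume "v \<in> row_module \<sigma> \<delta> (A \<star>\<^sub>m B)"
  then obtain c where "c \<in> carrier_vec (dim_row A)" "v = c \<star>\<^sub>r (A \<star>\<^sub>m B)"
    by (auto simp: row_module_def)
  thus "v \<in> row_module \<sigma> \<delta> B" using assms by (simp add: rmul_assoc row_moduleI)
qed

lemma functional_combination: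
  assumes "vector_functional \<sigma> \<delta> N E" "finite S" "\<And>j. j \<in> S \<Longrightarrow> u j \<in> carrier_vec N"
  shows "E (vec N (\<lambda>k. \<Sum>j\<in>S. u j $ k)) = (\<Sum>j\<in>S. E (u j))"
  using assms(2,3)
proof (induction S)
  case empty
  have "E (0\<^sub>v N + 0\<^sub>v N) = E (0\<^sub>v N) + E (0\<^sub>v N)"
    using assms(1) zero_carrier_vec unfolding vector_functional_def by blast
  hence "E (0\<^sub>v N) = 0" by (metis add_cancel_right_left add_carrier_vec left_zero_vec zero_carrier_vec)
  moreover have "vec N (\<lambda>k. \<Sum>j\<in>{}. u j $ k) = 0\<^sub>v N" by auto
  ultimately show ?case by simp
next
  case (insert i S)
  hence "vec N (\<lambda>k. \<Sum>j\<in>insert i S. u j $ k) = u i + vec N (\<lambda>k. \<Sum>j\<in>S. u j $ k)" by auto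
  moreover have "E (u i + vec N (\<lambda>k. \<Sum>j\<in>S. u j $ k)) = E (u i) + E (vec N (\<lambda>k. \<Sum>j\<in>S. u j $ k))"
    using assms(1) insert unfolding vector_functional_def by (metis insertI1 vec_carrier)
  ultimately show ?case using insert by simp
qed

lemma functional_rmul:
  assumes "vector_functional \<sigma> \<delta> N E" "B \<in> carrier_mat m N"
  shows "E (c \<star>\<^sub>r B) = (\<Sum>j<m. E (c $ j \<star>\<^sub>v row B j))"
  unfolding rmul_eq_combination[OF assms(2)]
  by (rule functional_combination[OF assms(1)]) (use assms(2) in auto)

subsection \<open>Indistinguishable matrices\<close>

definition indistinguishable :: "('a poly vec \<Rightarrow> 'a) \<Rightarrow> 'a poly mat \<Rightarrow> 'a poly mat \<Rightarrow> bool" where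
  "indistinguishable E B B' \<longleftrightarrow> (\<forall>j<dim_row B. \<forall>f. E (f \<star>\<^sub>v row B j) = E (f \<star>\<^sub>v row B' j))"

lemma indistinguishable_mmul:
  assumes E: "vector_functional \<sigma> \<delta> N E" and B: "B \<in> carrier_mat m N" "B' \<in> carrier_mat m N"
    and A: "A \<in> carrier_mat r m" and ind: "indistinguishable E B B'"
  shows "indistinguishable E (A \<star>\<^sub>m B) (A \<star>\<^sub>m B')"
  unfolding indistinguishable_def
proof (intro allI impI)
  fix j f assume "j < dim_row (A \<star>\<^sub>m B)"
  hence j: "j < r" using A by (simp add: skew_mat_mult_def)
  have *: "f \<star>\<^sub>v row (A \<star>\<^sub>m C) j = (f \<star>\<^sub>v row A j) \<star>\<^sub>r C" if "C \<in> carrier_mat m N" for C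
    using that A j by (simp add: row_mmul smult_rmul)
  show "E (f \<star>\<^sub>v row (A \<star>\<^sub>m B) j) = E (f \<star>\<^sub>v row (A \<star>\<^sub>m B') j)"
    using ind B by (simp add: * functional_rmul[OF E] indistinguishable_def)
qed

lemma mod_mat_carrier: "B \<in> carrier_mat m N \<Longrightarrow> skew_mod_mat \<sigma> \<delta> B M \<in> carrier_mat m N"
  by (auto simp: skew_mod_mat_def)

lemma indistinguishable_mod:
  assumes M: "\<forall>k<N. M $ k \<noteq> 0"
    and E: "\<And>Q. Q \<in> carrier_vec N \<Longrightarrow> E Q = E (skew_mod_vec \<sigma> \<delta> Q M)"
    and B: "B \<in> carrier_mat m N" "B' \<in> carrier_mat m N" and ind: "indistinguishable E B B'"
  shows "indistinguishable E B (skew_mod_mat \<sigma> \<delta> B' M)"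
  unfolding indistinguishable_def
proof (intro allI impI)
  fix j f assume "j < dim_row B"
  hence j: "j < m" using B by simp
  hence c: "row B' j \<in> carrier_vec N" using B by auto
  have r: "row (skew_mod_mat \<sigma> \<delta> B' M) j = skew_mod_vec \<sigma> \<delta> (row B' j) M"
    unfolding skew_mod_mat_def using j B by (subst mat_of_rows_row) (simp_all add: skew_mod_vec_def)
  have c': "skew_mod_vec \<sigma> \<delta> (row B' j) M \<in> carrier_vec N"
    using carrier_vecD[OF c] unfolding skew_mod_vec_def by (metis vec_carrier)
  have "E (f \<star>\<^sub>v row B j) = E (f \<star>\<^sub>v row B' j)" using ind j B by (simp add: indistinguishable_def)
  also have "\<dots> = E (skew_mod_vec \<sigma> \<delta> (f \<star>\<^sub>v row B' j) M)" using E c by simp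
  also have "\<dots> = E (skew_mod_vec \<sigma> \<delta> (f \<star>\<^sub>v skew_mod_vec \<sigma> \<delta> (row B' j) M) M)"
    using skew_mod_vec_smult_mod[OF c M] by simp
  also have "\<dots> = E (f \<star>\<^sub>v row (skew_mod_mat \<sigma> \<delta> B' M) j)" using E c' r by simp
  finally show "E (f \<star>\<^sub>v row B j) = E (f \<star>\<^sub>v row (skew_mod_mat \<sigma> \<delta> B' M) j)" .
qed

subsection \<open>The interpolation step\<close>

lemma has_pivot_sub_smult:
  assumes a: "has_pivot w a p D" and b: "has_pivot w b p' D'"
    and le: "D' < D \<or> D' = D \<and> p' < p" and dim: "dim_vec b = dim_vec a" "dim_vec v = dim_vec a"
    and v: "\<And>k. k < dim_vec a \<Longrightarrow> v $ k = a $ k + smult c (b $ k)"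
  shows "has_pivot w v p D"
proof -
  have "p < dim_vec a" "w $ p \<le> D" using a by (auto simp: has_pivot_def)
  moreover from this have "coeff (b $ p) (D - w $ p) = 0"
    using b le dim by (auto simp: has_pivot_def)
  ultimately show ?thesis
    using a b le dim v by (auto simp: has_pivot_def)
qed

lemma has_pivot_X_sub:
  assumes a: "has_pivot w a p D" and dim: "dim_vec v = dim_vec a"
    and v: "\<And>k. k < dim_vec a \<Longrightarrow> v $ k = X (a $ k) + smult c (a $ k)"
  shows "has_pivot w v p (D + 1)"
proof -
  have p: "p < dim_vec a" "w $ p \<le> D" "coeff (a $ p) (D - w $ p) \<noteq> 0"
    and z: "\<And>k i. k < dim_vec a \<Longrightarrow> D < i + w $ k \<or> p < k \<and> D = i + w $ k \<Longrightarrow> coeff (a $ k) i = 0"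
    using a by (auto simp: has_pivot_def)
  have cX: "coeff (X g) i = (case i of 0 \<Rightarrow> 0 | Suc n \<Rightarrow> \<sigma> (coeff g n)) + \<delta> (coeff g i)" for g i
    by (simp add: skew_X_mult_def coeff_map_poly coeff_pCons split: nat.split)
  have "coeff (v $ k) i = 0" if "k < dim_vec a" "D + 1 < i + w $ k \<or> p < k \<and> D + 1 = i + w $ k" for k i
    using z[OF that(1), of i] z[OF that(1), of "i - 1"] that by (cases i) (auto simp: v cX)
  moreover have "coeff (v $ p) (D + 1 - w $ p) \<noteq> 0"
    using p z[of p "Suc (D - w $ p)"] by (simp add: v cX Suc_diff_le)
  ultimately show ?thesis using p dim by (auto simp: has_pivot_def)
qed

text \<open>The output specification, with \<open>K\<close> the common kernel; linear independence of the rows of \<open>T B\<close>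
  is implied by the pivots being on the diagonal.\<close>

definition interpolates ::
    "nat \<Rightarrow> nat vec \<Rightarrow> 'a poly vec set \<Rightarrow> 'a poly mat \<Rightarrow> 'a poly mat \<Rightarrow> nat vec \<Rightarrow> bool" where
  "interpolates N w K B T d' \<longleftrightarrow> T \<in> carrier_mat N N \<and> d' \<in> carrier_vec N \<and>
     row_module \<sigma> \<delta> (T \<star>\<^sub>m B) = row_module \<sigma> \<delta> B \<inter> K \<and>
     (\<forall>j<N. has_pivot w (row (T \<star>\<^sub>m B) j) j (d' $ j))"

lemma interpolates_point:
  assumes B: "B \<in> carrier_mat N N" and B': "B' \<in> carrier_mat N N" and d: "d \<in> carrier_vec N"
    and E: "vector_functional \<sigma> \<delta> N E"
    and sub: "left_submodule \<sigma> \<delta> N (row_module \<sigma> \<delta> B \<inter> functional_kernel N E)"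
    and piv: "\<forall>j<N. has_pivot w (row B j) j (d $ j)"
    and ind: "indistinguishable E B B'"
    and res: "skew_interpolate_point \<sigma> \<delta> E B' d = (T, d')"
  shows "interpolates N w (functional_kernel N E) B T d'"
proof -
  define \<Delta> where "\<Delta> j = E (row B j)" for j
  define J where "J = {j. j < N \<and> \<Delta> j \<noteq> 0}"
  have \<Delta>': "E (row B' j) = \<Delta> j" "E (f \<star>\<^sub>v row B' j) = E (f \<star>\<^sub>v row B j)" if "j < N" for j f
    using ind that B unfolding indistinguishable_def \<Delta>_def by (metis smult_one carrier_matD(1))+
  have J': "{j. j < N \<and> E (row B' j) \<noteq> 0} = J"
    by (auto simp: J_def \<Delta>')
  have Econst: "E ([:a:] \<star>\<^sub>v row B j) = a * \<Delta> j" if "j < N" for a j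
    using E B that by (simp add: vector_functional_def \<Delta>_def)
  show ?thesis
  proof (cases "J = {}")
    case True
    hence "T = 1\<^sub>m N" "d' = d"
      using res B' J' by (auto simp: skew_interpolate_point_def Let_def)
    moreover have "row_module \<sigma> \<delta> B \<subseteq> row_module \<sigma> \<delta> B \<inter> functional_kernel N E"
    proof (rule row_module_subset[OF sub B])
      fix j assume "j < N"
      with True have "\<Delta> j = 0" by (auto simp: J_def)
      with \<open>j < N\<close> show "row B j \<in> row_module \<sigma> \<delta> B \<inter> functional_kernel N E"
        using B row_in_row_module[of j B] by (auto simp: functional_kernel_def \<Delta>_def)
    qed
    ultimately show ?thesis
      using B d piv mmul_one_left[of B] by (auto simp: interpolates_def)
  next
    case False
    define P where "P j \<longleftrightarrow> j \<in> J \<and> (\<forall>i\<in>J. d $ j \<le> d $ i)" for j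
    define j0 where "j0 = (LEAST j. P j)"
    define c where "c = E (monom 1 1 \<star>\<^sub>v row B j0) / \<Delta> j0"
    have "finite J" by (simp add: J_def)
    hence "Min ((\<lambda>j. d $ j) ` J) \<in> (\<lambda>j. d $ j) ` J" using False by (intro Min_in) auto
    then obtain j where "j \<in> J" "d $ j = Min ((\<lambda>j. d $ j) ` J)" by auto
    hence "P j" using \<open>finite J\<close> by (simp add: P_def)
    hence P0: "P j0" and least: "\<And>j. P j \<Longrightarrow> j0 \<le> j"
      unfolding j0_def by (auto intro: LeastI Least_le)
    hence j0: "j0 < N" "\<Delta> j0 \<noteq> 0" by (auto simp: P_def J_def)
    have T: "T = mat N N (\<lambda>(j, k). if k \<noteq> j0 then (if j = k then 1 else 0)
        else if j \<noteq> j0 then [:- \<Delta> j / \<Delta> j0:] else monom 1 1 - [:c:])"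
      and d': "d' = vec N (\<lambda>j. if j = j0 then d $ j + 1 else d $ j)"
    proof -
      have raw: "skew_interpolate_point \<sigma> \<delta> E B' d = (mat N N (\<lambda>(j, k).
          if k \<noteq> j0 then (if j = k then 1 else 0)
          else if j \<noteq> j0 then [:- E (row B' j) / E (row B' j0):]
          else monom 1 1 - [:E (monom 1 1 \<star>\<^sub>v row B' j0) / E (row B' j0):]),
        vec N (\<lambda>j. if j = j0 then d $ j + 1 else d $ j))"
        unfolding skew_interpolate_point_def Let_def carrier_matD(1)[OF B'] carrier_vecD[OF d]
          J' if_not_P[OF False] P_def[symmetric] j0_def[symmetric] ..
      show "T = mat N N (\<lambda>(j, k). if k \<noteq> j0 then (if j = k then 1 else 0)
        else if j \<noteq> j0 then [:- \<Delta> j / \<Delta> j0:] else monom 1 1 - [:c:])"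
        using raw res j0 by (auto simp: \<Delta>' c_def intro!: cong_mat)
      show "d' = vec N (\<lambda>j. if j = j0 then d $ j + 1 else d $ j)" using raw res by simp
    qed
    let ?C = "T \<star>\<^sub>m B"
    have C: "?C \<in> carrier_mat N N" using B by (auto simp: T intro: mmul_carrier)
    have row_ne: "?C $$ (j, k) = B $$ (j, k) + smult (- \<Delta> j / \<Delta> j0) (B $$ (j0, k))"
      if "j < N" "k < N" "j \<noteq> j0" for j k
    proof -
      have "?C $$ (j, k) = (\<Sum>i<N. T $$ (j, i) \<star> B $$ (i, k))"
        using B that by (simp add: skew_mat_mult_def T)
      also have "\<dots> = (\<Sum>i<N. (if i = j then B $$ (j, k) else 0)
          + (if i = j0 then smult (- \<Delta> j / \<Delta> j0) (B $$ (j0, k)) else 0))"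
        by (intro sum.cong) (use that in \<open>auto simp: T mult_1_left mult_const\<close>)
      also have "\<dots> = B $$ (j, k) + smult (- \<Delta> j / \<Delta> j0) (B $$ (j0, k))"
        using that j0 by (simp add: sum.distrib)
      finally show ?thesis .
    qed
    have row_eq: "?C $$ (j0, k) = (monom 1 1 - [:c:]) \<star> B $$ (j0, k)" if "k < N" for k
    proof -
      have "?C $$ (j0, k) = (\<Sum>i<N. T $$ (j0, i) \<star> B $$ (i, k))"
        using B that j0 by (simp add: skew_mat_mult_def T)
      also have "\<dots> = (\<Sum>i<N. if i = j0 then (monom 1 1 - [:c:]) \<star> B $$ (j0, k) else 0)"
        by (intro sum.cong) (use j0 in \<open>auto simp: T\<close>)
      finally show ?thesis using j0 by simp
    qed
    have minus_const: "monom 1 1 - [:c:] = monom 1 1 + [:- c:]" by simp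
    have diag: "(monom 1 1 - [:c:]) \<star> g = X g + smult (- c) g" for g
      unfolding minus_const mult_add_left mult_monom mult_const by simp
    have pivots: "has_pivot w (row ?C j) j (d' $ j)" if j: "j < N" for j
    proof (cases "j = j0")
      case True
      have "has_pivot w (row ?C j0) j0 (d $ j0 + 1)"
      proof (rule has_pivot_X_sub[where c = "- c"])
        show "has_pivot w (row B j0) j0 (d $ j0)" using piv j0 by blast
        show "dim_vec (row ?C j0) = dim_vec (row B j0)" using B C by simp
        show "row ?C j0 $ k = X (row B j0 $ k) + smult (- c) (row B j0 $ k)"
          if "k < dim_vec (row B j0)" for k
          using that j0 B C row_eq[of k] unfolding diag by (metis carrier_matD index_row)
      qed
      thus ?thesis using True j by (simp add: d')
    next
      case ne: False
      have "has_pivot w (row ?C j) j (d $ j)"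
      proof (cases "j \<in> J")
        case True
        have "d $ j0 \<le> d $ j" using P0 True by (simp add: P_def)
        moreover have "j0 \<le> j" if "d $ j = d $ j0"
          using least[of j] that P0 True by (simp add: P_def)
        ultimately have le: "d $ j0 < d $ j \<or> d $ j0 = d $ j \<and> j0 < j" using ne by linarith
        show ?thesis
        proof (rule has_pivot_sub_smult[OF _ _ le])
          show "has_pivot w (row B j) j (d $ j)" "has_pivot w (row B j0) j0 (d $ j0)"
            using piv j j0 by blast+
          show "dim_vec (row B j0) = dim_vec (row B j)" "dim_vec (row ?C j) = dim_vec (row B j)"
            using B C by simp_all
          show "row ?C j $ k = row B j $ k + smult (- \<Delta> j / \<Delta> j0) (row B j0 $ k)"
            if "k < dim_vec (row B j)" for k
            using that j j0 B C row_ne[of j k] ne by (metis carrier_matD index_row)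
        qed
      next
        case False
        hence "\<Delta> j = 0" using j by (simp add: J_def)
        have "row ?C j = row B j"
        proof (rule eq_vecI)
          fix k assume "k < dim_vec (row B j)"
          hence k: "k < N" using B by simp
          have "row ?C j $ k = ?C $$ (j, k)" using B j k by (simp add: T)
          also have "\<dots> = B $$ (j, k)" unfolding row_ne[OF j k ne] \<open>\<Delta> j = 0\<close> by simp
          also have "\<dots> = row B j $ k" using B j k by simp
          finally show "row ?C j $ k = row B j $ k" .
        qed (use B in simp)
        thus ?thesis using piv j by simp
      qed
      thus ?thesis using ne j by (simp add: d')
    qed
    have ker: "E (row ?C j) = 0" if j: "j < N" for j
    proof -
      let ?t = "\<lambda>i. T $$ (j, i) \<star>\<^sub>v row B i"
      have "E (row ?C j) = (\<Sum>i<N. E (?t i))"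
        using j B by (subst row_mmul) (simp_all add: T functional_rmul[OF E B])
      also have "\<dots> = 0"
      proof (cases "j = j0")
        case True
        have "(monom 1 1 - [:c:]) \<star>\<^sub>v row B j0 = monom 1 1 \<star>\<^sub>v row B j0 + [:- c:] \<star>\<^sub>v row B j0"
          unfolding minus_const by (rule add_smult_vec)
        hence "E ((monom 1 1 - [:c:]) \<star>\<^sub>v row B j0) = E (monom 1 1 \<star>\<^sub>v row B j0) + E ([:- c:] \<star>\<^sub>v row B j0)"
          using E B j0 by (simp add: vector_functional_def)
        also have "\<dots> = 0" using j0 by (simp only: Econst) (simp add: c_def)
        finally have "E (?t j0) = 0" using True j0 by (simp add: T)
        moreover have "E (?t i) = 0" if "i < N" "i \<noteq> j0" for i
          using Econst[of i 0] that True j0 by (simp add: T)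
        ultimately show ?thesis by (intro sum.neutral) auto
      next
        case False
        have "(\<Sum>i<N. E (?t i)) = (\<Sum>i<N. (if i = j then \<Delta> j else 0) + (if i = j0 then - \<Delta> j else 0))"
        proof (intro sum.cong refl)
          fix i assume "i \<in> {..<N}"
          thus "E (?t i) = (if i = j then \<Delta> j else 0) + (if i = j0 then - \<Delta> j else 0)"
            using Econst[of i "- \<Delta> j / \<Delta> j0"] Econst[of i 0] False j j0 by (auto simp: T \<Delta>_def)
        qed
        also have "\<dots> = 0" using j j0 by (simp add: sum.distrib)
        finally show ?thesis .
      qed
      finally show ?thesis .
    qed
    have "row_module \<sigma> \<delta> ?C \<subseteq> row_module \<sigma> \<delta> B \<inter> functional_kernel N E"
    proof (rule row_module_subset[OF sub C])
      fix j assume j: "j < N"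
      have "row ?C j \<in> row_module \<sigma> \<delta> B"
        using row_in_row_module[of j ?C] row_module_mmul_subset[of T B] j B C by (auto simp: T)
      thus "row ?C j \<in> row_module \<sigma> \<delta> B \<inter> functional_kernel N E"
        using ker[OF j] B row_carrier[of ?C j] by (simp add: functional_kernel_def)
    qed
    moreover have "v \<in> row_module \<sigma> \<delta> ?C" if v: "v \<in> row_module \<sigma> \<delta> B" "E v = 0" for v
    proof -
      obtain a where a: "a \<in> carrier_vec N" "v = a \<star>\<^sub>r B" using v B by (auto simp: row_module_def)
      define g where "g = a $ j0 - (\<Sum>j\<in>{..<N} - {j0}. a $ j \<star> [:- \<Delta> j / \<Delta> j0:])"
      have X0: "monom 1 1 - [:c:] \<noteq> 0" "degree (monom 1 1 - [:c:]) = 1"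
        by (simp_all add: monom_Suc)
      obtain h r where hr: "g = h \<star> (monom 1 1 - [:c:]) + r" "sdeg r < sdeg (monom 1 1 - [:c:])"
        using skew_right_division[OF X0(1), of g] by blast
      have "degree r = 0" using hr(2) X0 by (simp add: sdeg_def split: if_splits)
      then obtain r0 where r0: "r = [:r0:]" by (rule degree_eq_zeroE)
      define b where "b = vec N (\<lambda>j. if j = j0 then h else a $ j)"
      have split: "(\<Sum>j<N. u j) = u j0 + (\<Sum>j\<in>{..<N} - {j0}. u j)" for u :: "nat \<Rightarrow> 'a poly"
        using j0 by (intro sum.remove) auto
      have v_eq: "v = b \<star>\<^sub>r ?C + [:r0:] \<star>\<^sub>v row B j0"
      proof (rule eq_vecI)
        fix k assume "k < dim_vec (b \<star>\<^sub>r ?C + [:r0:] \<star>\<^sub>v row B j0)"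
        hence k: "k < N" using B by (simp add: skew_smult_vec_def)
        have ne: "(\<Sum>j\<in>{..<N} - {j0}. b $ j \<star> ?C $$ (j, k)) = (\<Sum>j\<in>{..<N} - {j0}. a $ j \<star> B $$ (j, k))
            + (\<Sum>j\<in>{..<N} - {j0}. a $ j \<star> [:- \<Delta> j / \<Delta> j0:]) \<star> B $$ (j0, k)"
          unfolding mult_sum_left sum.distrib[symmetric]
        proof (rule sum.cong)
          fix j assume "j \<in> {..<N} - {j0}"
          hence j: "j < N" "j \<noteq> j0" by auto
          hence "b $ j = a $ j" by (simp add: b_def)
          thus "b $ j \<star> ?C $$ (j, k)
              = a $ j \<star> B $$ (j, k) + a $ j \<star> [:- \<Delta> j / \<Delta> j0:] \<star> B $$ (j0, k)"
            unfolding row_ne[OF j(1) k j(2)] mult_add_right mult_assoc mult_const by simp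
        qed simp
        have "(b \<star>\<^sub>r ?C) $ k = (\<Sum>j<N. b $ j \<star> ?C $$ (j, k))"
          using B k by (simp add: skew_vec_mat_mult_def T)
        also have "\<dots> = h \<star> ((monom 1 1 - [:c:]) \<star> B $$ (j0, k)) + (\<Sum>j\<in>{..<N} - {j0}. b $ j \<star> ?C $$ (j, k))"
          using j0 k by (subst split) (simp add: b_def row_eq)
        finally have "(b \<star>\<^sub>r ?C) $ k + r \<star> B $$ (j0, k) = (g + (\<Sum>j\<in>{..<N} - {j0}. a $ j \<star> [:- \<Delta> j / \<Delta> j0:])) \<star> B $$ (j0, k)
            + (\<Sum>j\<in>{..<N} - {j0}. a $ j \<star> B $$ (j, k))"
          by (simp only: ne hr(1) mult_add_left mult_assoc ac_simps)
        also have "\<dots> = a $ j0 \<star> B $$ (j0, k) + (\<Sum>j\<in>{..<N} - {j0}. a $ j \<star> B $$ (j, k))"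
          by (simp add: g_def)
        also have "\<dots> = v $ k"
          using B k by (subst split[symmetric]) (simp add: a(2) skew_vec_mat_mult_def)
        finally have "(b \<star>\<^sub>r ?C) $ k + r \<star> B $$ (j0, k) = v $ k" .
        thus "v $ k = (b \<star>\<^sub>r ?C + [:r0:] \<star>\<^sub>v row B j0) $ k"
          using k j0 B by (simp add: r0 skew_smult_vec_def)
      qed (use a B j0 in \<open>simp add: skew_smult_vec_def skew_vec_mat_mult_def\<close>)
      have bC: "b \<star>\<^sub>r ?C \<in> row_module \<sigma> \<delta> ?C" by (rule row_moduleI) (simp add: b_def T)
      hence "E (b \<star>\<^sub>r ?C) = 0"
        using \<open>row_module \<sigma> \<delta> ?C \<subseteq> _\<close> by (auto simp: functional_kernel_def)
      moreover have "E v = E (b \<star>\<^sub>r ?C) + E ([:r0:] \<star>\<^sub>v row B j0)"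
      proof -
        have "b \<star>\<^sub>r ?C \<in> carrier_vec N" "[:r0:] \<star>\<^sub>v row B j0 \<in> carrier_vec N"
          using B by (simp_all add: carrier_vecI)
        thus ?thesis unfolding v_eq using E by (simp add: vector_functional_def)
      qed
      ultimately have "r0 = 0" using v(2) Econst[OF j0(1), of r0] j0(2) by simp
      hence "v = b \<star>\<^sub>r ?C"
        unfolding v_eq using B j0 by (auto simp: skew_smult_vec_def skew_vec_mat_mult_def)
      thus ?thesis using bC by simp
    qed
    ultimately have "row_module \<sigma> \<delta> ?C = row_module \<sigma> \<delta> B \<inter> functional_kernel N E"
      by (auto simp: functional_kernel_def)
    thus ?thesis using pivots by (auto simp: interpolates_def T d')
  qed
qed

subsection \<open>The recursion\<close>

lemma interpolates_tree:
  assumes E: "\<And>l. l < n \<Longrightarrow> vector_functional \<sigma> \<delta> N (E l)"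
    and M: "\<And>i j. i \<le> j \<Longrightarrow> j < n \<Longrightarrow> \<forall>k<N. M i j $ k \<noteq> 0"
    and EM: "\<And>i j l Q. i \<le> j \<Longrightarrow> j < n \<Longrightarrow> i \<le> l \<Longrightarrow> l \<le> j \<Longrightarrow> Q \<in> carrier_vec N \<Longrightarrow>
           E l Q = E l (skew_mod_vec \<sigma> \<delta> Q (M i j))"
    and "i1 \<le> i2" "i2 < n" "B \<in> carrier_mat N N" "B' \<in> carrier_mat N N" "d \<in> carrier_vec N"
    and "\<And>i. i1 \<le> i \<Longrightarrow> i \<le> i2 \<Longrightarrow>
           left_submodule \<sigma> \<delta> N (row_module \<sigma> \<delta> B \<inter> (\<Inter>l\<in>{i1..i}. functional_kernel N (E l)))"
    and "\<forall>j<N. has_pivot w (row B j) j (d $ j)"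
    and "\<And>l. i1 \<le> l \<Longrightarrow> l \<le> i2 \<Longrightarrow> indistinguishable (E l) B B'"
    and "skew_interpolate_tree \<sigma> \<delta> E M i1 i2 B' d = (T, d')"
  shows "interpolates N w (\<Inter>l\<in>{i1..i2}. functional_kernel N (E l)) B T d'"
  using assms(4-)
proof (induction "i2 - i1" arbitrary: i1 i2 B B' d T d' rule: less_induct)
  case less
  note i = less.prems(1,2) and B = less.prems(3) and B' = less.prems(4) and d = less.prems(5)
    and sub = less.prems(6) and piv = less.prems(7) and ind = less.prems(8) and res = less.prems(9)
  let ?K = "\<lambda>i j. \<Inter>l\<in>{i..j}. functional_kernel N (E l)"
  show ?case
  proof (cases "i1 = i2")
    case True
    have "skew_interpolate_point \<sigma> \<delta> (E i1) B' d = (T, d')"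
      using res True by (simp add: skew_interpolate_tree.simps[of _ _ _ _ i1])
    with interpolates_point[OF B B' d E[OF i(2)] _ piv ind] sub[of i1] True i
    show ?thesis by simp
  next
    case False
    define z where "z = (i1 + i2) div 2"
    have z: "i1 \<le> z" "z < i2" "z < n" using False i by (auto simp: z_def)
    define B1 where "B1 = skew_mod_mat \<sigma> \<delta> B' (M i1 z)"
    obtain T1 d1 where R1: "skew_interpolate_tree \<sigma> \<delta> E M i1 z B1 d = (T1, d1)" by fastforce
    define B2 where "B2 = skew_mod_mat \<sigma> \<delta> (T1 \<star>\<^sub>m B') (M (z + 1) i2)"
    obtain T2 d2 where R2: "skew_interpolate_tree \<sigma> \<delta> E M (z + 1) i2 B2 d1 = (T2, d2)" by fastforce
    have T: "T = T2 \<star>\<^sub>m T1" "d' = d2"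
    proof -
      have nle: "\<not> i2 \<le> i1" using False i(1) by simp
      have "skew_interpolate_tree \<sigma> \<delta> E M i1 i2 B' d = (T2 \<star>\<^sub>m T1, d2)"
        by (subst skew_interpolate_tree.simps)
          (simp only: nle if_False Let_def z_def[symmetric] B1_def[symmetric] R1 prod.case
            B2_def[symmetric] R2)
      thus "T = T2 \<star>\<^sub>m T1" "d' = d2" using res by simp_all
    qed
    have int1: "interpolates N w (?K i1 z) B T1 d1"
    proof (rule less.hyps[OF _ _ _ B _ d _ piv _ R1])
      show "B1 \<in> carrier_mat N N" unfolding B1_def by (rule mod_mat_carrier[OF B'])
      show "indistinguishable (E l) B B1" if "i1 \<le> l" "l \<le> z" for l
        unfolding B1_def
        by (rule indistinguishable_mod[OF M EM B B' ind]) (use that z in auto)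
    qed (use z sub in auto)
    let ?C = "T1 \<star>\<^sub>m B"
    have T1: "T1 \<in> carrier_mat N N" and d1: "d1 \<in> carrier_vec N"
      and mod1: "row_module \<sigma> \<delta> ?C = row_module \<sigma> \<delta> B \<inter> ?K i1 z"
      and piv1: "\<forall>j<N. has_pivot w (row ?C j) j (d1 $ j)"
      using int1 by (auto simp: interpolates_def)
    have C: "?C \<in> carrier_mat N N" and C': "T1 \<star>\<^sub>m B' \<in> carrier_mat N N"
      by (rule mmul_carrier[OF T1 B] mmul_carrier[OF T1 B'])+
    have inter: "row_module \<sigma> \<delta> ?C \<inter> ?K (z + 1) j = row_module \<sigma> \<delta> B \<inter> ?K i1 j" if "z < j" for j
    proof -
      have "{i1..j} = {i1..z} \<union> {z + 1..j}" using z that by auto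
      thus ?thesis unfolding mod1 by (simp add: INF_union Int_assoc)
    qed
    have "interpolates N w (?K (z + 1) i2) ?C T2 d2"
    proof (rule less.hyps[OF _ _ _ C _ d1 _ piv1 _ R2])
      show "B2 \<in> carrier_mat N N" unfolding B2_def by (rule mod_mat_carrier[OF C'])
      show "indistinguishable (E l) ?C B2" if "z + 1 \<le> l" "l \<le> i2" for l
        unfolding B2_def
        by (rule indistinguishable_mod[OF M EM C C' indistinguishable_mmul[OF E B B' T1 ind]])
          (use that z i in auto)
      show "left_submodule \<sigma> \<delta> N (row_module \<sigma> \<delta> ?C \<inter> ?K (z + 1) j)" if "z + 1 \<le> j" "j \<le> i2" for j
        using that z sub[of j] inter[of j] by simp
    qed (use z i in auto)
    moreover have "T2 \<in> carrier_mat N N" using calculation by (simp add: interpolates_def)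
    moreover have "T \<star>\<^sub>m B = T2 \<star>\<^sub>m ?C"
      using B T1 calculation(2) unfolding T by (intro mmul_assoc) auto
    ultimately show ?thesis
      using inter[of i2] z mmul_carrier[OF _ T1] T by (auto simp: interpolates_def)
  qed
qed

end

theorem lemma6:
  fixes \<sigma> \<delta> :: "'a::{field,finite} \<Rightarrow> 'a"
    and q m s n i1 i2 :: nat
    and w d dhat :: "nat vec"
    and E :: "nat \<Rightarrow> 'a poly vec \<Rightarrow> 'a"
    and M :: "nat \<Rightarrow> nat \<Rightarrow> 'a poly vec"
    and B T :: "'a poly mat"
  assumes "primepow q" and "m \<ge> 1" and "CARD('a) = q ^ m"
    and "field_automorphism \<sigma>" and "skew_derivation \<sigma> \<delta>"
    and "s \<ge> 1" and "n \<ge> 1"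
    and "w \<in> carrier_vec (s + 1)"
    and "\<And>l. l < n \<Longrightarrow> vector_functional \<sigma> \<delta> (s + 1) (E l)"
    and "\<And>i. i < n \<Longrightarrow> left_submodule \<sigma> \<delta> (s + 1) (\<Inter>l\<in>{0..i}. functional_kernel (s + 1) (E l))"
    and "\<And>i j. i \<le> j \<Longrightarrow> j < n \<Longrightarrow>
           M i j \<in> carrier_vec (s + 1) \<and> (\<forall>k<s + 1. M i j $ k \<noteq> 0)"
    and "\<And>i j l Q. i \<le> j \<Longrightarrow> j < n \<Longrightarrow> i \<le> l \<Longrightarrow> l \<le> j \<Longrightarrow> Q \<in> carrier_vec (s + 1) \<Longrightarrow>
           E l Q = E l (skew_mod_vec \<sigma> \<delta> Q (M i j))"
    and "i1 \<le> i2" and "i2 < n"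
    and "B \<in> carrier_mat (s + 1) (s + 1)"
    and "ordered_weak_popov w B"
    and "\<And>i. 0 < i1 \<Longrightarrow> i1 \<le> i \<Longrightarrow> i \<le> i2 \<Longrightarrow>
           left_submodule \<sigma> \<delta> (s + 1) (row_module \<sigma> \<delta> B \<inter> (\<Inter>l\<in>{i1..i}. functional_kernel (s + 1) (E l)))"
    and "d \<in> carrier_vec (s + 1)"
    and "\<And>j. j < s + 1 \<Longrightarrow> Fin (d $ j) = wdeg w (row B j)"
    and "skew_interpolate_tree \<sigma> \<delta> E M i1 i2 B d = (T, dhat)"
  shows "T \<in> carrier_mat (s + 1) (s + 1) \<and>
    ordered_weak_popov_basis \<sigma> \<delta> (s + 1) w (skew_mat_mult \<sigma> \<delta> T B)
      (row_module \<sigma> \<delta> B \<inter> (\<Inter>l\<in>{i1..i2}. functional_kernel (s + 1) (E l))) \<and>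
    dhat \<in> carrier_vec (s + 1) \<and>
    (\<forall>j<s + 1. Fin (dhat $ j) = wdeg w (row (skew_mat_mult \<sigma> \<delta> T B) j))"
proof -
  interpret skew_poly_ring \<sigma> \<delta> using assms(4,5) by unfold_locales
  let ?N = "s + 1" and ?K = "\<lambda>i j. \<Inter>l\<in>{i..j}. functional_kernel (s + 1) (E l)"
  note B = assms(15)
  have sub: "left_submodule \<sigma> \<delta> ?N (row_module \<sigma> \<delta> B \<inter> ?K i1 i)" if "i1 \<le> i" "i \<le> i2" for i
  proof (cases "i1 = 0")
    case True
    thus ?thesis
      using left_submodule_Int[OF _ assms(10)[of i]] left_submodule_row_module[of B] B that assms(14)
      by auto
  qed (use assms(17) that in auto)
  have piv: "\<forall>j<?N. has_pivot w (row B j) j (d $ j)"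
    using ordered_weak_popov_iff_diagonal_pivots[OF B] assms(16,19) by blast
  have "interpolates ?N w (?K i1 i2) B T dhat"
    by (rule interpolates_tree[where n = n and M = M, OF _ _ _ assms(13,14) B B assms(18) sub piv _ assms(20)])
      (use assms(9,11,12) in \<open>auto simp: indistinguishable_def\<close>)
  hence T: "T \<in> carrier_mat ?N ?N" and dhat: "dhat \<in> carrier_vec ?N"
    and mod: "row_module \<sigma> \<delta> (T \<star>\<^sub>m B) = row_module \<sigma> \<delta> B \<inter> ?K i1 i2"
    and piv': "\<forall>j<?N. has_pivot w (row (T \<star>\<^sub>m B) j) j (dhat $ j)"
    by (auto simp: interpolates_def)
  have C: "T \<star>\<^sub>m B \<in> carrier_mat ?N ?N" by (rule mmul_carrier[OF T B])
  have indep: "rows_left_indep \<sigma> \<delta> (T \<star>\<^sub>m B) {..<?N}"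
    by (rule diagonal_pivots_imp_indep[OF C, where w = w and d = dhat]) (use piv' in blast)
  have rank: "left_row_rank \<sigma> \<delta> (T \<star>\<^sub>m B) = ?N"
    using left_row_rank_indep[of "T \<star>\<^sub>m B"] indep T by simp
  show ?thesis
    using ordered_weak_popov_iff_diagonal_pivots[OF C, THEN iffD2, OF piv'] T dhat mod indep rank C
      sub[OF assms(13) order_refl]
    by (simp add: ordered_weak_popov_basis_def)
qed

end
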